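(* For every real $c>0$, there exist infinitely many pairs $(m,n)\in\mathbb{N}^2$ such that $$1 \leq \sum_{\ell=n}^{m}\frac{1}{\ell} \leq 1+\frac{c}{n^2}.$$
   Context: $\mathbb{N}$ denotes the set of positive integers. *)

theory Defs
  imports Complex_Main
begin

end

theory Submission
  imports Defs "HOL-Analysis.Equivalence_Lebesgue_Henstock_Integration" "HOL-Real_Asymp.Real_Asymp"
begin

text \<open>
  Write \<open>N = 2n - 1\<close> and \<open>M = 2m + 1\<close>. Comparing \<open>1/l\<close> with \<open>ln (l + 1/2) - ln (l - 1/2)\<close>, the sum
  equals \<open>ln (M/N) - (1/N^2 - 1/M^2)/6\<close> up to \<open>o(1/N^2)\<close>. If \<open>N (M - e N) = \<theta>\<close> is bounded, then
  \<open>ln (M/N) = 1 + \<theta>/(e N^2) + o(1/N^2)\<close>, so \<open>N^2\<close> times the excess over 1 is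
  \<open>\<theta>/e - (1 - 1/e^2)/6 + o(1)\<close>, and it suffices to find infinitely many odd \<open>M, N\<close> for which \<open>\<theta>\<close> lies in a
  prescribed interval. The diagonal Pade approximants of the exponential function at 1 give odd \<open>p, q\<close>
  with \<open>\<delta> = q (p - e q)\<close> positive and arbitrarily small. Taking \<open>M = t p\<close> and \<open>N = t q\<close> yields
  \<open>\<theta> = t^2 \<delta>\<close>, and the squares of odd \<open>t\<close> are dense enough for \<open>\<theta>\<close> to hit the interval.
\<close>

subsection \<open>Sums of reciprocals and logarithms\<close>

text \<open>The right side minus the left tends to 0 at infinity and is strictly decreasing, so it
  is positive. The right side is chosen to telescope under \<open>x \<mapsto> x + 1\<close>.\<close>

lemma ln_step_le:
  fixes x :: real
  assumes "x \<ge> 1"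
  shows "ln (x + 1/2) - ln (x - 1/2) - 1 / x \<le> (1/24) * (1 / (x - 1/2)^2 - 1 / (x + 1/2)^2)"
proof -
  define h where "h = (\<lambda>x::real. (1/24) * (1 / (x - 1/2)^2 - 1 / (x + 1/2)^2)
      - (ln (x + 1/2) - ln (x - 1/2) - 1 / x))"
  have "(h \<longlongrightarrow> 0) at_top"
    unfolding h_def by real_asymp
  moreover have "\<exists>d. (h has_real_derivative d) (at y) \<and> d < 0" if "y \<ge> x" for y
  proof -
    have y: "y \<ge> 1" using that assms by simp
    \<comment> \<open>In terms of \<open>p = (y - 1/2) * (y + 1/2)\<close> the derivative is a
      rational function whose sign is visible.\<close>
    define p where "p = y^2 - 1/4"
    have "1 \<le> y^2" using y by simp
    then have p: "p > 0" by (simp add: p_def)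
    have ab: "(y - 1/2) * (y + 1/2) = p" by (simp add: p_def algebra_simps power2_eq_square)
    have nz: "y - 1/2 > 0" "y + 1/2 > 0" using y by auto
    have d: "(h has_real_derivative ((1/24) * (- 2 / (y - 1/2)^3 + 2 / (y + 1/2)^3)
        - (1 / (y + 1/2) - 1 / (y - 1/2) + 1 / y^2))) (at y)"
      unfolding h_def using nz y
      by (auto intro!: derivative_eq_intros simp: power2_eq_square power3_eq_cube)
         (simp add: divide_simps, simp add: algebra_simps)
    have 1: "1 / (y + 1/2) - 1 / (y - 1/2) = - 1 / p"
      unfolding ab[symmetric] using nz by (simp add: field_simps)
    have frac: "- 2 / a^3 + 2 / b^3 = - 2 * (b^3 - a^3) / (a * b)^3" if "a > 0" "b > 0" for a b :: real
      using that by (simp add: power_mult_distrib diff_divide_distrib)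
    have "- 2 / (y - 1/2)^3 + 2 / (y + 1/2)^3 = - 2 * ((y + 1/2)^3 - (y - 1/2)^3) / ((y - 1/2) * (y + 1/2))^3"
      by (rule frac[OF nz])
    also have "(y + 1/2)^3 - (y - 1/2)^3 = 3 * p + 1"
      by (simp add: p_def power3_eq_cube power2_eq_square algebra_simps)
    finally have 2: "- 2 / (y - 1/2)^3 + 2 / (y + 1/2)^3 = - 2 * (3 * p + 1) / p^3"
      by (simp add: ab)
    have y2: "y^2 = p + 1/4" by (simp add: p_def)
    have "(1/24) * (- 2 * (3 * p + 1) / p^3) - (- 1 / p + 1 / (p + 1/4)) = - (7 * p + 1) / (4 * p^3 * (12 * p + 3))"
      using p by (simp add: divide_simps power3_eq_cube) (simp add: algebra_simps)
    also have "\<dots> < 0" using p by (simp add: divide_neg_pos)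
    finally show ?thesis using d unfolding 1 2 y2 by blast
  qed
  ultimately have "0 < h x" by (intro DERIV_neg_imp_decreasing_at_top) auto
  then show ?thesis by (simp add: h_def)
qed

text \<open>The sharper minorant \<open>1 / (12 * x^3)\<close>, the leading term of the left side,
  follows by the same monotonicity argument; it dominates the stated difference, which again
  telescopes.\<close>

lemma ln_step_ge:
  fixes x :: real
  assumes "x \<ge> 1"
  shows "ln (x + 1/2) - ln (x - 1/2) - 1 / x \<ge> (1/24) * (1 / x^2 - 1 / (x + 1)^2)"
proof -
  define h where "h = (\<lambda>x::real. ln (x + 1/2) - ln (x - 1/2) - 1 / x - 1 / (12 * x^3))"
  have "(h \<longlongrightarrow> 0) at_top"
    unfolding h_def by real_asymp
  moreover have "\<exists>d. (h has_real_derivative d) (at y) \<and> d < 0" if "y \<ge> x" for y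
  proof -
    have y: "y \<ge> 1" using that assms by simp
    define p where "p = y^2 - 1/4"
    have "1 \<le> y^2" using y by simp
    then have p: "p > 0" by (simp add: p_def)
    have ab: "(y - 1/2) * (y + 1/2) = p" by (simp add: p_def algebra_simps power2_eq_square)
    have nz: "y - 1/2 > 0" "y + 1/2 > 0" using y by auto
    have d: "(h has_real_derivative (1 / (y + 1/2) - 1 / (y - 1/2) + 1 / y^2 + 1 / (4 * (y^2)^2))) (at y)"
      unfolding h_def using nz y
      by (auto intro!: derivative_eq_intros simp: power2_eq_square power3_eq_cube)
    have 1: "1 / (y + 1/2) - 1 / (y - 1/2) = - 1 / p"
      unfolding ab[symmetric] using nz by (simp add: field_simps)
    have y2: "y^2 = p + 1/4" by (simp add: p_def)
    have "- 1 / p + 1 / (p + 1/4) + 1 / (4 * (p + 1/4)^2) = - 1 / (p * (4 * p + 1)^2)"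
      using p by (simp add: divide_simps power2_eq_square) (simp add: algebra_simps)
    also have "\<dots> < 0" using p by (simp add: divide_neg_pos)
    finally show ?thesis using d unfolding 1 y2 by blast
  qed
  ultimately have "0 < h x" by (intro DERIV_neg_imp_decreasing_at_top) auto
  moreover have "(1/24) * (1 / x^2 - 1 / (x + 1)^2) \<le> 1 / (12 * x^3)"
  proof -
    have "1 / x^2 - 1 / (x + 1)^2 = (2 * x + 1) * x / (x^3 * (x + 1)^2)"
      using assms by (simp add: divide_simps) (simp add: algebra_simps power2_eq_square power3_eq_cube)
    also have "\<dots> \<le> (2 * (x + 1)^2) / (x^3 * (x + 1)^2)"
      using assms by (intro divide_right_mono) (auto simp: algebra_simps power2_eq_square)
    also have "\<dots> = 2 / x^3" using assms by simp
    finally show ?thesis by simp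
  qed
  ultimately show ?thesis by (simp add: h_def)
qed

text \<open>Both step bounds telescope; doubling the half-integers to \<open>N\<close> and
  \<open>M\<close> turns 1/24 into 1/6. The two estimates differ only by shifts by 1 in the
  denominators, which is \<open>o(1/N^2)\<close>.\<close>

lemma sum_inverse_bounds:
  fixes n m :: nat
  assumes "1 \<le> n" "n \<le> m"
  defines "N \<equiv> 2 * real n - 1" and "M \<equiv> 2 * real m + 1"
  shows "ln M - ln N - (1/6) * (1 / N^2 - 1 / M^2) \<le> (\<Sum>l=n..m. 1 / real l)"
    and "(\<Sum>l=n..m. 1 / real l) \<le> ln M - ln N - (1/6) * (1 / (N + 1)^2 - 1 / (M + 1)^2)"
proof -
  have half: "ln (2 * a) - ln (2 * b) = ln a - ln b" if "a > 0" "b > 0" for a b :: real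
    using that by (simp add: ln_mult)
  have tele: "(\<Sum>l=n..m. f (real l + 1) - f (real l)) = f (real m + 1) - f (real n)" for f :: "real \<Rightarrow> real"
    using sum_Suc_diff[of n m "\<lambda>l. f (real l)"] assms(2) by (simp add: add.commute)
  have MN: "ln M - ln N = ln (real m + 1/2) - ln (real n - 1/2)"
    using half[of "real m + 1/2" "real n - 1/2"] assms by (simp add: algebra_simps)
  have "(\<Sum>l=n..m. (ln (real l + 1/2) - ln (real l - 1/2)) -
        (1/24) * (1 / (real l - 1/2)^2 - 1 / (real l + 1/2)^2)) \<le> (\<Sum>l=n..m. 1 / real l)"
  proof (rule sum_mono)
    fix l assume "l \<in> {n..m}"
    then show "(ln (real l + 1/2) - ln (real l - 1/2)) -
        (1/24) * (1 / (real l - 1/2)^2 - 1 / (real l + 1/2)^2) \<le> 1 / real l"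
      using ln_step_le[of "real l"] assms(1) by (simp add: algebra_simps)
  qed
  also have "(\<Sum>l=n..m. (ln (real l + 1/2) - ln (real l - 1/2)) -
        (1/24) * (1 / (real l - 1/2)^2 - 1 / (real l + 1/2)^2))
      = (\<Sum>l=n..m. (ln ((real l + 1) - 1/2) + (1/24) / ((real l + 1) - 1/2)^2) -
        (ln (real l - 1/2) + (1/24) / (real l - 1/2)^2))"
    by (rule sum.cong) (auto simp: algebra_simps)
  also have "\<dots> = (ln (real m + 1 - 1/2) + (1/24) / (real m + 1 - 1/2)^2) - (ln (real n - 1/2) + (1/24) / (real n - 1/2)^2)"
    by (rule tele)
  also have "\<dots> = ln M - ln N - (1/6) * (1 / N^2 - 1 / M^2)"
  proof -
    have "M^2 = 4 * (real m + 1 - 1/2)^2" "N^2 = 4 * (real n - 1/2)^2"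
      by (auto simp: M_def N_def power2_eq_square algebra_simps)
    then show ?thesis unfolding MN by (simp add: algebra_simps)
  qed
  finally show "ln M - ln N - (1/6) * (1 / N^2 - 1 / M^2) \<le> (\<Sum>l=n..m. 1 / real l)" .
  have "(\<Sum>l=n..m. 1 / real l) \<le> (\<Sum>l=n..m. (ln (real l + 1/2) - ln (real l - 1/2)) -
        (1/24) * (1 / (real l)^2 - 1 / (real l + 1)^2))"
  proof (rule sum_mono)
    fix l assume "l \<in> {n..m}"
    then show "1 / real l \<le> (ln (real l + 1/2) - ln (real l - 1/2)) -
        (1/24) * (1 / (real l)^2 - 1 / (real l + 1)^2)"
      using ln_step_ge[of "real l"] assms(1) by (simp add: algebra_simps)
  qed
  also have "\<dots>
      = (\<Sum>l=n..m. (ln ((real l + 1) - 1/2) + (1/24) / (real l + 1)^2) -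
        (ln (real l - 1/2) + (1/24) / (real l)^2))"
    by (rule sum.cong) (auto simp: algebra_simps)
  also have "\<dots> = (ln (real m + 1 - 1/2) + (1/24) / (real m + 1)^2) - (ln (real n - 1/2) + (1/24) / (real n)^2)"
    by (rule tele)
  also have "\<dots> = ln M - ln N - (1/6) * (1 / (N + 1)^2 - 1 / (M + 1)^2)"
  proof -
    have "(M + 1)^2 = 4 * (real m + 1)^2" "(N + 1)^2 = 4 * (real n)^2"
      by (auto simp: M_def N_def power2_eq_square algebra_simps)
    then show ?thesis unfolding MN by (simp add: algebra_simps)
  qed
  finally show "(\<Sum>l=n..m. 1 / real l) \<le> ln M - ln N - (1/6) * (1 / (N + 1)^2 - 1 / (M + 1)^2)" .
qed

subsection \<open>Diagonal Pade approximants of the exponential function at 1\<close>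

text \<open>With \<open>pade_den\<close> this gives 1/1, 3/1, 19/7, 193/71, and so on. The
  multipliers \<open>4 * n + 6\<close> are even, so parity is inherited from two steps back and all
  terms are odd.\<close>

fun pade_num :: "nat \<Rightarrow> nat" where
  "pade_num 0 = 1"
| "pade_num (Suc 0) = 3"
| "pade_num (Suc (Suc n)) = (4 * n + 6) * pade_num (Suc n) + pade_num n"

fun pade_den :: "nat \<Rightarrow> nat" where
  "pade_den 0 = 1"
| "pade_den (Suc 0) = 1"
| "pade_den (Suc (Suc n)) = (4 * n + 6) * pade_den (Suc n) + pade_den n"

lemma odd_pade_num: "odd (pade_num n)"
  by (induction n rule: pade_num.induct) auto

lemma odd_pade_den: "odd (pade_den n)"
  by (induction n rule: pade_den.induct) auto

lemma pade_den_pos: "pade_den n > 0"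
  using odd_pade_den[of n] by (rule odd_pos)

text \<open>Both sequences solve the same recurrence with coefficient 1 at the older term, so their
  determinant only changes sign at each step.\<close>

lemma pade_det:
  "real (pade_num (Suc n)) * real (pade_den n) - real (pade_num n) * real (pade_den (Suc n)) = 2 * (-1) ^ n"
proof (induction n)
  case (Suc n)
  then show ?case by (simp add: algebra_simps)
qed simp

text \<open>Hermite's integrand: its integral over [0, 1] is the approximation error up to sign, and
  its positivity on (0, 1) fixes the sign of that error.\<close>

definition pade_integrand :: "nat \<Rightarrow> real \<Rightarrow> real" where
  "pade_integrand n x = (x * (1 - x)) ^ n / fact n * exp x"

definition pade_remainder :: "nat \<Rightarrow> real" where
  "pade_remainder n = integral {0..1} (pade_integrand n)"

lemma pade_integrand_integrable: "pade_integrand n integrable_on {0..1}"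
  unfolding pade_integrand_def by (intro integrable_continuous_interval continuous_intros) auto

lemma pade_remainder_0: "pade_remainder 0 = exp 1 - 1"
proof -
  have "(exp has_integral (exp 1 - exp 0)) {0..1::real}"
    by (rule fundamental_theorem_of_calculus)
       (auto intro!: derivative_eq_intros simp flip: has_real_derivative_iff_has_vector_derivative)
  then show ?thesis
    unfolding pade_remainder_def pade_integrand_def by (simp add: integral_unique)
qed

lemma pade_remainder_1: "pade_remainder (Suc 0) = 3 - exp 1"
proof -
  define F where "F = (\<lambda>x::real. (- (x^2) + 3 * x - 3) * exp x)"
  have "(F has_real_derivative x * (1 - x) * exp x) (at x within {0..1})" for x
    unfolding F_def by (rule derivative_eq_intros refl)+ (simp add: algebra_simps power2_eq_square)
  then have "((\<lambda>x. x * (1 - x) * exp x) has_integral (F 1 - F 0)) {0..1}"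
    by (intro fundamental_theorem_of_calculus)
       (auto simp flip: has_real_derivative_iff_has_vector_derivative)
  then show ?thesis
    unfolding pade_remainder_def pade_integrand_def by (simp add: integral_unique F_def)
qed

text \<open>With \<open>f j = (x (1 - x))^j / j!\<close> one has \<open>f (n + 2)'' = f n - (4 n + 6) f (n + 1)\<close>, so the
  combination of integrands is the derivative of \<open>(f (n + 2)' - f (n + 2)) exp\<close>, which vanishes at
  0 and 1.\<close>
lemma pade_remainder_rec:
  "pade_remainder (Suc (Suc n)) = pade_remainder n - (4 * real n + 6) * pade_remainder (Suc n)"
proof -
  define F where "F = (\<lambda>x::real. (1 - 2 * x) * ((x * (1 - x)) ^ Suc n / fact (Suc n)) * exp x
      - pade_integrand (Suc (Suc n)) x)"
  have "(F has_real_derivative (pade_integrand n x - (4 * real n + 6) * pade_integrand (Suc n) x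
      - pade_integrand (Suc (Suc n)) x)) (at x within {0..1})" for x
  proof -
    define f where "f = (\<lambda>j (x::real). (x * (1 - x)) ^ j / fact j)"
    have f': "(f (Suc j) has_real_derivative (1 - 2 * x) * f j x) (at x within {0..1})" for j
    proof -
      have "((\<lambda>x::real. (x * (1 - x)) ^ Suc j)
          has_real_derivative real (Suc j) * ((1 - 2 * x) * (x * (1 - x)) ^ j)) (at x within {0..1})"
        by (rule derivative_eq_intros refl)+ simp
      from DERIV_cdivide[OF this, of "fact (Suc j)"] show ?thesis
        by (simp add: f_def fact_Suc del: power_Suc of_nat_Suc)
    qed
    have w: "real (Suc n) * f (Suc n) x = x * (1 - x) * f n x"
      by (simp add: f_def divide_simps fact_Suc)
    \<comment> \<open>This rests on \<open>(1 - 2 * x)^2 = 1 - 4 * x * (1 - x)\<close>.\<close>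
    have sq: "(1 - 2 * x) * ((1 - 2 * x) * f n x) = f n x - 4 * (real (Suc n) * f (Suc n) x)"
      unfolding w by (simp add: algebra_simps)
    have integrand: "pade_integrand j x = f j x * exp x" for j x
      by (simp add: f_def pade_integrand_def)
    have F: "F = (\<lambda>x. ((1 - 2 * x) * f (Suc n) x - f (Suc (Suc n)) x) * exp x)"
      by (simp add: F_def f_def pade_integrand_def fun_eq_iff algebra_simps)
    have "(F has_real_derivative ((- 2 * f (Suc n) x + (1 - 2 * x) * ((1 - 2 * x) * f n x) - f (Suc (Suc n)) x) * exp x))
        (at x within {0..1})"
      unfolding F by (rule derivative_eq_intros f' refl)+ (simp add: algebra_simps)
    also have "(- 2 * f (Suc n) x + (1 - 2 * x) * ((1 - 2 * x) * f n x) - f (Suc (Suc n)) x) * exp x =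
        pade_integrand n x - (4 * real n + 6) * pade_integrand (Suc n) x - pade_integrand (Suc (Suc n)) x"
      unfolding sq by (simp add: integrand algebra_simps)
    finally show ?thesis .
  qed
  then have int_F: "((\<lambda>x. pade_integrand n x - (4 * real n + 6) * pade_integrand (Suc n) x
      - pade_integrand (Suc (Suc n)) x) has_integral (F 1 - F 0)) {0..1}"
    by (intro fundamental_theorem_of_calculus)
       (auto simp flip: has_real_derivative_iff_has_vector_derivative)
  have int_R: "((\<lambda>x. pade_integrand n x - (4 * real n + 6) * pade_integrand (Suc n) x
      - pade_integrand (Suc (Suc n)) x) has_integral
      (pade_remainder n - (4 * real n + 6) * pade_remainder (Suc n) - pade_remainder (Suc (Suc n)))) {0..1}"
    unfolding pade_remainder_def
    by (intro has_integral_diff has_integral_mult_right integrable_integral pade_integrand_integrable)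
  have "F 1 - F 0 = 0" by (simp add: F_def pade_integrand_def)
  with has_integral_unique[OF int_F int_R] show ?thesis by simp
qed

text \<open>The factor \<open>(-1) ^ n\<close> converts the recurrence of numerators and
  denominators into that of the integrals; the cases 0 and 1 match.\<close>

lemma pade_remainder_eq:
  "pade_remainder n = (-1) ^ n * (exp 1 * real (pade_den n) - real (pade_num n))"
proof (induction n rule: pade_num.induct)
  case (3 n)
  then show ?case by (simp only: pade_remainder_rec 3) (simp add: algebra_simps)
qed (simp_all add: pade_remainder_0 pade_remainder_1)

lemma pade_remainder_pos: "pade_remainder n > 0"
proof -
  have "integral {0..1} (\<lambda>x::real. 0) < integral {0..1} (pade_integrand n)"
  proof (rule integral_less_real)
    show "continuous_on {0..1} (pade_integrand n)"
      unfolding pade_integrand_def by (intro continuous_intros) auto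
  qed (auto simp: pade_integrand_def)
  then show ?thesis by (simp add: pade_remainder_def)
qed

text \<open>The determinant identity becomes \<open>R n * Q (Suc n) + R (Suc n) * Q n = 2\<close>
  with positive terms, so \<open>Q n * R n\<close> is below \<open>2 * Q n / Q (Suc n)\<close>,
  which the growing multipliers make small.\<close>

lemma odd_approximations_exp_1:
  fixes \<epsilon> :: real
  assumes "\<epsilon> > 0"
  obtains p q :: nat where "odd p" "odd q"
    "0 < real q * (real p - exp 1 * real q)" "real q * (real p - exp 1 * real q) < \<epsilon>"
proof -
  obtain k :: nat where k: "2 / \<epsilon> < real k" using reals_Archimedean2 by blast
  \<comment> \<open>An odd index puts the fraction above \<open>exp 1\<close>, and the next
    multiplier \<open>8 * k + 6\<close> exceeds \<open>k\<close>.\<close>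
  define n where "n = Suc (2 * k)"
  define P where "P = (\<lambda>j. real (pade_num j))"
  define Q where "Q = (\<lambda>j. real (pade_den j))"
  define R where "R = pade_remainder"
  have R: "R j = (-1) ^ j * (exp 1 * Q j - P j)" for j
    by (simp add: R_def P_def Q_def pade_remainder_eq)
  have odd: "odd n" by (simp add: n_def)
  have Rn: "R n = P n - exp 1 * Q n" using odd R[of n] by simp
  have RSn: "R (Suc n) = exp 1 * Q (Suc n) - P (Suc n)" using odd R[of "Suc n"] by simp
  have pos: "R j > 0" "Q j > 0" for j
    by (simp_all add: R_def Q_def pade_remainder_pos pade_den_pos)
  have "R n * Q (Suc n) + R (Suc n) * Q n = 2"
    using pade_det[of n] odd unfolding Rn RSn P_def Q_def by (simp add: algebra_simps)
  then have less2: "R n * Q (Suc n) < 2" using mult_pos_pos[OF pos(1)[of "Suc n"] pos(2)[of n]] by linarith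
  have "real k * Q n \<le> Q (Suc n)"
    using pos(2)[of n] by (simp add: n_def Q_def algebra_simps)
  then have "real k * (Q n * R n) \<le> R n * Q (Suc n)"
    using pos(1)[of n] by (simp add: mult.commute mult.left_commute mult_left_mono)
  with less2 have "real k * (Q n * R n) < 2" by linarith
  moreover have "2 < real k * \<epsilon>" using k assms by (simp add: field_simps)
  ultimately have "real k * (Q n * R n) < real k * \<epsilon>" by linarith
  then have "Q n * R n < \<epsilon>" by (simp add: mult_less_cancel_left)
  moreover have "Q n * R n > 0" using pos by simp
  ultimately show ?thesis
    using that[OF odd_pade_num[of n] odd_pade_den[of n]] by (simp add: Rn P_def Q_def)
qed

subsection \<open>Odd multiples of the approximants\<close>

text \<open>Multiplying \<open>p\<close> and \<open>q\<close> by an odd \<open>t\<close> keeps them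
  odd and scales \<open>q * (p - e * q)\<close> by \<open>t^2\<close>. After taking square roots, an
  arithmetic progression has to meet \<open>[sqrt A, sqrt B]\<close>.\<close>

lemma odd_scaled_approximations_exp_1:
  fixes A B :: real
  assumes "0 < A" "A < B"
  obtains M N :: nat where "odd M" "odd N" "K < N"
    "A \<le> real N * (real M - exp 1 * real N)" "real N * (real M - exp 1 * real N) \<le> B"
proof -
  \<comment> \<open>The first bound forces the multiplier \<open>t\<close> to exceed \<open>K\<close>; the second makes the step \<open>2 sqrt d\<close> of
    \<open>t sqrt d\<close> over odd \<open>t\<close> at most \<open>sqrt B - sqrt A\<close>.\<close>
  define \<epsilon> where "\<epsilon> = min (A / (real K + 1)^2) (((sqrt B - sqrt A) / 2)^2)"
  have "sqrt A < sqrt B" using assms by simp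
  then have "\<epsilon> > 0" using assms by (simp add: \<epsilon>_def)
  then obtain p q :: nat where pq: "odd p" "odd q"
    "0 < real q * (real p - exp 1 * real q)" "real q * (real p - exp 1 * real q) < \<epsilon>"
    by (rule odd_approximations_exp_1)
  define d where "d = real q * (real p - exp 1 * real q)"
  have d: "0 < d" "d < \<epsilon>" using pq by (auto simp: d_def)
  define r where "r = sqrt A / sqrt d"
  have r: "r > 0" using assms d by (simp add: r_def)
  \<comment> \<open>This makes \<open>t = 2 * z + 1\<close> the least odd integer that is at least
    \<open>r\<close>; since \<open>r > 0\<close>, \<open>z\<close> is nonnegative and
    \<open>nat z\<close> loses nothing.\<close>
  define z where "z = \<lceil>(r - 1) / 2\<rceil>"
  have z: "0 \<le> z" "(r - 1) / 2 \<le> real_of_int z" "real_of_int z \<le> (r - 1) / 2 + 1"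
    unfolding z_def using r by (simp_all add: le_ceiling_iff)
  define t where "t = 2 * nat z + 1"
  have "real t = 2 * real_of_int z + 1" using z by (simp add: t_def)
  then have t: "r \<le> real t" "real t \<le> r + 2" using z by (simp_all add: field_simps)
  have rd: "r * sqrt d = sqrt A" using d by (simp add: r_def)
  have lo: "sqrt A \<le> real t * sqrt d"
    unfolding rd[symmetric] using t d by (intro mult_right_mono) auto
  have "sqrt d \<le> sqrt (((sqrt B - sqrt A) / 2)^2)"
    using d(2) by (intro real_sqrt_le_mono) (simp add: \<epsilon>_def)
  also have "\<dots> = (sqrt B - sqrt A) / 2" using \<open>sqrt A < sqrt B\<close> by simp
  finally have sd: "2 * sqrt d \<le> sqrt B - sqrt A" by simp
  have "real t * sqrt d \<le> (r + 2) * sqrt d" using t d by (intro mult_right_mono) auto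
  also have "\<dots> \<le> sqrt B" using sd rd by (simp add: algebra_simps)
  finally have hi: "real t * sqrt d \<le> sqrt B" .
  have sq: "(real t * sqrt d)^2 = real (t * q) * (real (t * p) - exp 1 * real (t * q))"
    using d by (simp add: power_mult_distrib) (simp add: d_def power2_eq_square algebra_simps)
  have "d * (real K + 1)^2 < A" using d by (simp add: \<epsilon>_def field_simps)
  then have "sqrt (d * (real K + 1)^2) < sqrt A" by (rule real_sqrt_less_mono)
  then have "sqrt d * (real K + 1) < sqrt A" by (simp add: real_sqrt_mult)
  with lo have "sqrt d * (real K + 1) < sqrt d * real t" by (simp add: mult.commute)
  then have "real K + 1 < real t" using d by simp
  then have "K < t" by linarith
  also have "t \<le> t * q" using odd_pos[OF pq(2)] by simp
  finally have K: "K < t * q" .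
  show ?thesis
  proof (rule that)
    show "odd (t * p)" "odd (t * q)" using pq by (auto simp: t_def)
    show "K < t * q" by (rule K)
    show "A \<le> real (t * q) * (real (t * p) - exp 1 * real (t * q))"
      using power_mono[OF lo, of 2] assms unfolding sq by simp
    show "real (t * q) * (real (t * p) - exp 1 * real (t * q)) \<le> B"
      using power_mono[OF hi, of 2] assms d unfolding sq by simp
  qed
qed


section \<open>Choice of the interval for \<theta> and the final estimates\<close>

theorem theorem1:
  fixes c :: real
  assumes "c > 0"
  shows "infinite {(m, n). m \<ge> (1::nat) \<and> n \<ge> (1::nat) \<and>
           1 \<le> (\<Sum>l=n..m. 1 / real l) \<and>
           (\<Sum>l=n..m. 1 / real l) \<le> 1 + c / (real n)^2}"
    (is "infinite ?S")
proof -
  define e :: real where "e = exp 1"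
  have e: "e > 1" by (simp add: e_def)
  \<comment> \<open>The limit of \<open>N^2 * (1/6) * (1 / N^2 - 1 / M^2)\<close> when
    \<open>M / N\<close> tends to \<open>e\<close>.\<close>
  define k where "k = (1/6) * (1 - 1 / e^2)"
  have k: "k > 0" using e by (simp add: k_def)
  \<comment> \<open>With \<theta> between \<open>A\<close> and \<open>B\<close>, the scaled excess
    \<theta>\<open>/e - k\<close> lies between \<open>c > 0\<close> and \<open>3 * c\<close>,
    leaving room below \<open>4 * c\<close>; the factor 4 is absorbed by
    \<open>N + 1 = 2 * n\<close>.\<close>
  define A where "A = e * (k + c)"
  define B where "B = e * (k + 3 * c)"
  have AB: "0 < A" "A < B" "0 < B" using e k assms by (simp_all add: A_def B_def add_pos_pos)
  have "((\<lambda>N. A / e - B^2 / (e^2 * N^2) - (1/6) * (1 - N^2 / (e * N + B / N)^2))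
      \<longlongrightarrow> A / e - (1/6) * (1 - 1 / e^2)) at_top"
    using e AB by real_asymp (simp add: field_simps)
  moreover have "A / e - (1/6) * (1 - 1 / e^2) = c" using e by (simp add: A_def k_def)
  ultimately have "((\<lambda>N. A / e - B^2 / (e^2 * N^2) - (1/6) * (1 - N^2 / (e * N + B / N)^2)) \<longlongrightarrow> c) at_top"
    by (simp only:)
  from order_tendstoD(1)[OF this assms]
  have E1: "eventually (\<lambda>N. A / e - B^2 / (e^2 * N^2) - (1/6) * (1 - N^2 / (e * N + B / N)^2) > 0) at_top" .
  have "((\<lambda>N. (N + 1)^2 / N^2 * (B / e) - (1/6) * (1 - (N + 1)^2 / (e * N + 1)^2))
      \<longlongrightarrow> B / e - (1/6) * (1 - 1 / e^2)) at_top"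
    using e AB by real_asymp (simp add: field_simps)
  moreover have "B / e - (1/6) * (1 - 1 / e^2) = 3 * c" using e by (simp add: B_def k_def)
  ultimately have "((\<lambda>N. (N + 1)^2 / N^2 * (B / e) - (1/6) * (1 - (N + 1)^2 / (e * N + 1)^2)) \<longlongrightarrow> 3 * c) at_top"
    by (simp only:)
  from order_tendstoD(2)[OF this, of "4 * c"]
  have E2: "eventually (\<lambda>N. (N + 1)^2 / N^2 * (B / e) - (1/6) * (1 - (N + 1)^2 / (e * N + 1)^2) < 4 * c) at_top"
    using assms by simp
  \<comment> \<open>Ensures \<open>x \<le> 1\<close> below, as required by the bound
    \<open>x - x^2 \<le> ln (1 + x)\<close>.\<close>
  have E3: "eventually (\<lambda>N. B / (e * N^2) < 1) at_top"
  proof (rule order_tendstoD)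
    show "((\<lambda>N. B / (e * N^2)) \<longlongrightarrow> 0) at_top" using e AB by real_asymp
  qed simp
  obtain K where K: "\<And>N. N \<ge> K \<Longrightarrow>
      A / e - B^2 / (e^2 * N^2) - (1/6) * (1 - N^2 / (e * N + B / N)^2) > 0 \<and>
      (N + 1)^2 / N^2 * (B / e) - (1/6) * (1 - (N + 1)^2 / (e * N + 1)^2) < 4 * c \<and>
      B / (e * N^2) < 1"
    using eventually_conj[OF E1 eventually_conj[OF E2 E3]] unfolding eventually_at_top_linorder by blast
  \<comment> \<open>Unbounded second components give an infinite projection, hence an infinite
    set.\<close>
  have large: "\<exists>z\<in>?S. L < snd z" for L
  proof -
    obtain M' N' :: nat where odd: "odd M'" "odd N'" and big: "max (nat \<lceil>K\<rceil>) (2 * L) < N'"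
      and MN: "A \<le> real N' * (real M' - exp 1 * real N')" "real N' * (real M' - exp 1 * real N') \<le> B"
      using odd_scaled_approximations_exp_1[OF AB(1,2)] by blast
    obtain m where m: "M' = 2 * m + 1" using odd by (elim oddE)
    obtain n0 where n0: "N' = 2 * n0 + 1" using odd by (elim oddE)
    define n where "n = Suc n0"
    define N where "N = 2 * real n - 1"
    define M where "M = 2 * real m + 1"
    have NM': "real N' = N" "real M' = M" by (simp_all add: N_def M_def m n0 n_def)
    define \<theta> where "\<theta> = N * (M - e * N)"
    have \<theta>: "A \<le> \<theta>" "\<theta> \<le> B" using MN by (simp_all add: \<theta>_def e_def NM')
    have N: "N > 0" "N \<ge> K" using big by (simp_all add: NM'[symmetric] n0) linarith
    note K = K[OF N(2)]
    define x where "x = \<theta> / (e * N^2)"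
    have x: "x > 0" using \<theta> AB e N by (simp add: x_def)
    have M: "M = e * N * (1 + x)" "M = e * N + \<theta> / N"
      using N e by (simp_all add: x_def \<theta>_def field_simps power2_eq_square)
    have MeN: "M > e * N" using M(2) \<theta> AB N by simp
    moreover have "e * N > N" using e N by simp
    ultimately have "M > N" by linarith
    then have nm: "n \<le> m" by (simp add: M_def N_def)
    have "ln M = ln e + ln N + ln (1 + x)"
      unfolding M(1) using e N x by (simp add: ln_mult)
    then have lnMN: "ln M - ln N = 1 + ln (1 + x)" by (simp add: e_def)
    have "x \<le> B / (e * N^2)" unfolding x_def using \<theta> e N by (intro divide_right_mono) auto
    then have "x \<le> 1" using K by linarith
    then have ln_lo: "x - x^2 \<le> ln (1 + x)" using x by (intro ln_one_plus_pos_lower_bound) auto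
    have ln_hi: "ln (1 + x) \<le> x" using x by (intro ln_add_one_self_le_self) auto
    define S where "S = (\<Sum>l=n..m. 1 / real l)"
    have n1: "1 \<le> n" by (simp add: n_def)
    note bounds = sum_inverse_bounds[OF n1 nm, folded N_def M_def S_def, unfolded lnMN]
    have "1 \<le> S"
    proof -
      \<comment> \<open>Worst case term by term: \<theta> is replaced by \<open>A\<close> where it
        helps and by \<open>B\<close> where it hurts.\<close>
      have "A / e - B^2 / (e^2 * N^2) - (1/6) * (1 - N^2 / (e * N + B / N)^2)
          \<le> \<theta> / e - \<theta>^2 / (e^2 * N^2) - (1/6) * (1 - N^2 / M^2)"
        unfolding M(2) using \<theta> AB e N
        by (intro diff_mono mult_left_mono divide_right_mono divide_left_mono
            power_mono add_mono mult_pos_pos zero_less_power add_pos_pos divide_pos_pos) auto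
      also have "\<dots> = N^2 * (x - x^2 - (1/6) * (1 / N^2 - 1 / M^2))"
        using N e by (simp add: x_def power_divide power_mult_distrib right_diff_distrib)
           (simp add: field_simps power2_eq_square power4_eq_xxxx)
      finally have "0 < N^2 * (x - x^2 - (1/6) * (1 / N^2 - 1 / M^2))" using K by linarith
      then have "0 < x - x^2 - (1/6) * (1 / N^2 - 1 / M^2)"
        using N by (simp add: zero_less_mult_iff)
      then show ?thesis using bounds(1) ln_lo by linarith
    qed
    moreover have "S \<le> 1 + c / (real n)^2"
    proof -
      have "(N + 1)^2 * (x - (1/6) * (1 / (N + 1)^2 - 1 / (M + 1)^2))
          = (N + 1)^2 / N^2 * (\<theta> / e) - (1/6) * (1 - (N + 1)^2 / (M + 1)^2)"
        using N e by (simp add: x_def right_diff_distrib mult.commute)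
      \<comment> \<open>Here \<theta> \<open>\<le> B\<close> bounds the first term and
        \<open>M > e * N\<close> the second.\<close>
      also have "\<dots> \<le> (N + 1)^2 / N^2 * (B / e) - (1/6) * (1 - (N + 1)^2 / (e * N + 1)^2)"
        using \<theta> AB e N MeN \<open>M > N\<close>
        by (intro diff_mono mult_left_mono divide_right_mono divide_left_mono
            power_mono add_mono mult_pos_pos zero_less_power add_pos_pos divide_pos_pos) auto
      also have "\<dots> < 4 * c" using K by blast
      finally have "x - (1/6) * (1 / (N + 1)^2 - 1 / (M + 1)^2) < 4 * c / (N + 1)^2"
        using N by (simp add: pos_less_divide_eq mult.commute)
      also have "\<dots> = c / (real n)^2" by (simp add: N_def power_mult_distrib)
      finally show ?thesis using bounds(2) ln_hi by linarith
    qed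
    moreover have "L < n" using big by (simp add: n0 n_def)
    ultimately show ?thesis using n1 nm unfolding S_def by (intro bexI[of _ "(m, n)"]) auto
  qed
  have "infinite (snd ` ?S)"
    unfolding infinite_nat_iff_unbounded
  proof
    fix L
    obtain z where "z \<in> ?S" "L < snd z" using large by blast
    then show "\<exists>n>L. n \<in> snd ` ?S" by (intro exI[of _ "snd z"] conjI imageI)
  qed
  then show ?thesis by (rule contrapos_nn) (rule finite_imageI)
qed

end
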